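(* Let $n\geq2$, let $D$ be a strictly convex domain of $\mathbb{C}^n$, let $f_1,f_2$ be holomorphic on a neighborhood of $\overline D$, $X_l=\{z:\ f_l(z)=0\}$, and suppose that $X_1\cap bD$ and $X_2\cap bD$ are transverse and that $X_1\cap X_2$ is a complete intersection. Let $g$ be holomorphic on $D$ and let $g_1,g_2$ be two bounded holomorphic functions on $D$ such that $g=g_1f_1+g_2f_2$. Then $$\left\|\frac{g}{\max(|f_1|,|f_2|)}\right\|_{L^\infty(D)}\lesssim\max\left(\|g_1\|_{L^\infty(D)},\|g_2\|_{L^\infty(D)}\right)$$ and, for $l=1,2$, $$c^{(l)}_\infty(g)\lesssim\sup_{z\in D,\ v\in\mathbb{C}^n,\ |v|=1}\ \ \sup_{b\Delta_{z,v}\left(4\kappa\tau(z,v,|\rho(z)|)\right)}|g_l|.$$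
   Context: The (bounded) strictly convex domain is written $D=\{z\in\mathbb{C}^n:\ \rho(z)<0\}$, where $\rho$ is a smooth strictly convex function on $\mathbb{C}^n$ whose gradient does not vanish in a neighborhood of $bD$. $A\lesssim B$ means $A\leq cB$ for a constant $c>0$ not depending on $g,g_1,g_2$. "$X_l\cap bD$ is transverse" means transverse in the sense of tangent cones: at each point of $X_l\cap bD$ the tangent cone of $X_l$ is transverse to the tangent space of $bD$. "Complete intersection" means of codimension $2$ (or empty). For $z\in\mathbb{C}^n$, a unit vector $v\in\mathbb{C}^n$ and $\varepsilon>0$, $$\tau(z,v,\varepsilon)=\sup\{\tau>0:\ \rho(z+\lambda v)-\rho(z)<\varepsilon\ \text{for all }\lambda\in\mathbb{C},\ |\lambda|<\tau\},$$ and $\Delta_{z,v}(r)=\{z+\lambda v:\ |\lambda|<r\}$, with boundary circle $b\Delta_{z,v}(r)$. $\kappa>0$ is a fixed, sufficiently small constant. Set $\Lambda^{(1)}_{z,v}=\{\lambda\in\mathbb{C}:\ |\lambda|<\tau(z,v,3\kappa|\rho(z)|),\ z+\lambda v\in X_2\setminus X_1\}$ and $\Lambda^{(2)}_{z,v}=\{\lambda\in\mathbb{C}:\ |\lambda|<\tau(z,v,3\kappa|\rho(z)|),\ z+\lambda v\in X_1\setminus X_2\}$. Set $g^{(1)}=g/f_1$ on $(X_2\setminus X_1)\cap D$ and $g^{(2)}=g/f_2$ on $(X_1\setminus X_2)\cap D$. For a function $h$ on a subset of $\mathbb{C}^n$, divided differences are defined by $h_{z,v}[\lambda]=h(z+\lambda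 v)$ and, for pairwise distinct $\lambda_i$, $$h_{z,v}[\lambda_1,\dots,\lambda_{k+1}]=\frac{h_{z,v}[\lambda_1,\dots,\lambda_k]-h_{z,v}[\lambda_2,\dots,\lambda_{k+1}]}{\lambda_1-\lambda_{k+1}}.$$ Finally $$c^{(l)}_\infty(g)=\sup\left(\left|g^{(l)}_{z,v}[\lambda_1,\dots,\lambda_k]\right|\ \tau(z,v,|\rho(z)|)^{k-1}\right),$$ the supremum being taken over all $z\in D$, all $v\in\mathbb{C}^n$ with $|v|=1$, and all pairwise distinct $\lambda_1,\dots,\lambda_k\in\Lambda^{(l)}_{z,v}$.
   Formalization: In the supremum defining c_∞^(l)(g) the number k of points is bounded by an arbitrary N, and the constant may depend on N; with k unbounded the claim fails (unit ball, f_1=z_1, f_2=z_2, g_1=1/(a-z_1)). Strictly convex means that ρ has positive definite real Hessian. *)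

theory Defs
  imports "HOL-Analysis.Analysis" "HOL-Probability.Essential_Supremum"
begin

text \<open>\<open>\<complex>\<^sup>n\<close> is \<^typ>\<open>complex ^ 'n\<close> with its Euclidean norm, \<open>n = CARD('n)\<close>; \<open>\<lambda> *s v\<close> is
  multiplication by a complex scalar. Real differentials are Frechet derivatives over the reals.\<close>

subsection \<open>Holomorphic functions of several variables\<close>

definition holo_on :: "(complex ^ 'n \<Rightarrow> complex) \<Rightarrow> (complex ^ 'n) set \<Rightarrow> bool" where
  "holo_on f U \<longleftrightarrow> open U \<and>
     (\<forall>z\<in>U. \<exists>f'. (f has_derivative f') (at z) \<and> (\<forall>a w. f' (a *s w) = a * f' w))"

subsection \<open>Strictly convex domains\<close>

fun Ck :: "nat \<Rightarrow> ('a::real_normed_vector \<Rightarrow> real) \<Rightarrow> bool" where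
  "Ck 0 f \<longleftrightarrow> continuous_on UNIV f"
| "Ck (Suc k) f \<longleftrightarrow> (\<forall>x. f differentiable (at x)) \<and>
     (\<forall>v. Ck k (\<lambda>x. frechet_derivative f (at x) v))"

definition smooth :: "('a::real_normed_vector \<Rightarrow> real) \<Rightarrow> bool" where
  "smooth f \<longleftrightarrow> (\<forall>k. Ck k f)"

definition hessian :: "('a::real_normed_vector \<Rightarrow> real) \<Rightarrow> 'a \<Rightarrow> 'a \<Rightarrow> 'a \<Rightarrow> real" where
  "hessian f z v w = frechet_derivative (\<lambda>x. frechet_derivative f (at x) v) (at z) w"

text \<open>Strict convexity in the sense of several complex variables: the real Hessian is positive
  definite everywhere (not merely the strict convexity inequality).\<close>

definition smooth_strictly_convex :: "('a::real_normed_vector \<Rightarrow> real) \<Rightarrow> bool" where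
  "smooth_strictly_convex f \<longleftrightarrow> smooth f \<and> (\<forall>z w. w \<noteq> 0 \<longrightarrow> hessian f z w w > 0)"

definition sublevel :: "(complex ^ 'n \<Rightarrow> real) \<Rightarrow> (complex ^ 'n) set" where
  "sublevel \<rho> = {z. \<rho> z < 0}"

definition strictly_convex_domain :: "(complex ^ 'n \<Rightarrow> real) \<Rightarrow> bool" where
  "strictly_convex_domain \<rho> \<longleftrightarrow> smooth_strictly_convex \<rho> \<and>
     sublevel \<rho> \<noteq> {} \<and> bounded (sublevel \<rho>) \<and>
     (\<exists>V. open V \<and> frontier (sublevel \<rho>) \<subseteq> V \<and> (\<forall>z\<in>V. frechet_derivative \<rho> (at z) \<noteq> (\<lambda>_. 0)))"

subsection \<open>Zero sets, dimension, tangent cones\<close>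

definition zero_set :: "(complex ^ 'n) set \<Rightarrow> (complex ^ 'n \<Rightarrow> complex) \<Rightarrow> (complex ^ 'n) set" where
  "zero_set U f = {z\<in>U. f z = 0}"

text \<open>Near \<open>p\<close>, the set \<open>A\<close> is a complex submanifold of dimension \<open>d\<close>: a biholomorphic
  change of coordinates takes it to a coordinate subspace.\<close>

definition regular_point :: "(complex ^ 'n) set \<Rightarrow> complex ^ 'n \<Rightarrow> nat \<Rightarrow> bool" where
  "regular_point A p d \<longleftrightarrow> p \<in> A \<and>
     (\<exists>V W (\<Phi> :: complex ^ 'n \<Rightarrow> complex ^ 'n) \<Psi> I. open V \<and> p \<in> V \<and> open W \<and> homeomorphism V W \<Phi> \<Psi> \<and>
        (\<forall>i. holo_on (\<lambda>z. \<Phi> z $ i) V) \<and> (\<forall>i. holo_on (\<lambda>w. \<Psi> w $ i) W) \<and>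
        card I = d \<and> \<Phi> ` (A \<inter> V) = {w\<in>W. \<forall>i. i \<notin> I \<longrightarrow> w $ i = 0})"

text \<open>The dimension of a nonempty analytic set is the largest dimension of its regular points.\<close>

definition analytic_dim :: "(complex ^ 'n) set \<Rightarrow> nat" where
  "analytic_dim A = Sup {d. \<exists>p. regular_point A p d}"

definition complete_intersection2 :: "(complex ^ 'n) set \<Rightarrow> bool" where
  "complete_intersection2 A \<longleftrightarrow> A = {} \<or> analytic_dim A + 2 = CARD('n)"

definition tangent_cone :: "(complex ^ 'n) set \<Rightarrow> complex ^ 'n \<Rightarrow> (complex ^ 'n) set" where
  "tangent_cone A p = {w. \<exists>(x :: nat \<Rightarrow> complex ^ 'n) (t :: nat \<Rightarrow> real).
     (\<forall>j. x j \<in> A \<and> t j > 0) \<and> x \<longlonglongrightarrow> p \<and> (\<lambda>j. t j *\<^sub>R (x j - p)) \<longlonglongrightarrow> w}"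

text \<open>A cone is transverse to a real hyperplane \<open>T\<close> through the origin if none of its irreducible
  components is contained in \<open>T\<close> (for a linear cone \<open>C\<close> this says that \<open>C + T\<close> is the whole space).
  The irreducible components of an analytic set are the closures of the connected components of its
  set of regular points; as \<open>T\<close> is closed, taking the closure makes no difference.\<close>

definition transverse_cone :: "(complex ^ 'n) set \<Rightarrow> (complex ^ 'n) set \<Rightarrow> bool" where
  "transverse_cone C T \<longleftrightarrow> (\<forall>K \<in> components {w. \<exists>d. regular_point C w d}. \<not> K \<subseteq> T)"

definition transverse_to_bd :: "(complex ^ 'n \<Rightarrow> real) \<Rightarrow> (complex ^ 'n) set \<Rightarrow> bool" where
  "transverse_to_bd \<rho> X \<longleftrightarrow> (\<forall>p \<in> X \<inter> frontier (sublevel \<rho>).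
     transverse_cone (tangent_cone X p) {w. frechet_derivative \<rho> (at p) w = 0})"

subsection \<open>Discs in complex directions and divided differences\<close>

definition tau :: "(complex ^ 'n \<Rightarrow> real) \<Rightarrow> complex ^ 'n \<Rightarrow> complex ^ 'n \<Rightarrow> real \<Rightarrow> real" where
  "tau \<rho> z v \<epsilon> = Sup {t. t > 0 \<and> (\<forall>l::complex. cmod l < t \<longrightarrow> \<rho> (z + l *s v) - \<rho> z < \<epsilon>)}"

definition bDisc :: "complex ^ 'n \<Rightarrow> complex ^ 'n \<Rightarrow> real \<Rightarrow> (complex ^ 'n) set" where
  "bDisc z v r = {z + l *s v | l. cmod l = r}"

text \<open>\<open>div_diff h z v [\<lambda>\<^sub>1, \<dots>, \<lambda>\<^sub>k]\<close> is \<open>h\<^bsub>z,v\<^esub>[\<lambda>\<^sub>1, \<dots>, \<lambda>\<^sub>k]\<close>; the empty list is a junk case.\<close>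

function div_diff ::
  "(complex ^ 'n \<Rightarrow> complex) \<Rightarrow> complex ^ 'n \<Rightarrow> complex ^ 'n \<Rightarrow> complex list \<Rightarrow> complex" where
  "div_diff h z v [] = 0"
| "div_diff h z v [l] = h (z + l *s v)"
| "div_diff h z v (l # m # ls) =
     (div_diff h z v (butlast (l # m # ls)) - div_diff h z v (m # ls)) / (l - last (m # ls))"
  by pat_completeness auto
termination by (relation "Wellfounded.measure (\<lambda>(h, z, v, ls). length ls)") auto

definition Lam :: "(complex ^ 'n \<Rightarrow> real) \<Rightarrow> real \<Rightarrow> (complex ^ 'n) set \<Rightarrow> complex ^ 'n
    \<Rightarrow> complex ^ 'n \<Rightarrow> complex set" where
  "Lam \<rho> \<kappa> Y z v = {l. cmod l < tau \<rho> z v (3 * \<kappa> * \<bar>\<rho> z\<bar>) \<and> z + l *s v \<in> Y}"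

text \<open>\<open>c_inf \<rho> \<kappa> Y N h\<close> is the supremum defining \<open>c\<^sub>\<infinity>\<close> of a function \<open>h\<close> on \<open>Y\<close>, with the
  number \<open>k\<close> of points running over \<open>1 \<le> k \<le> N\<close>. Without a bound on \<open>k\<close> the supremum may be
  infinite when \<open>Y\<close> contains an open piece of a complex line: divided differences of
  \<open>1 / (a - \<lambda>)\<close> are \<open>1 / (\<Prod>i\<le>k. a - \<lambda>\<^sub>i)\<close>, which grows exponentially in \<open>k\<close> for
  \<open>\<lambda>\<^sub>i\<close> near \<open>a\<close>.\<close>

definition c_inf :: "(complex ^ 'n \<Rightarrow> real) \<Rightarrow> real \<Rightarrow> (complex ^ 'n) set \<Rightarrow> nat
    \<Rightarrow> (complex ^ 'n \<Rightarrow> complex) \<Rightarrow> ennreal" where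
  "c_inf \<rho> \<kappa> Y N h =
     (SUP (z, v, ls) \<in> {(z, v, ls). z \<in> sublevel \<rho> \<and> norm v = 1 \<and> 1 \<le> length ls \<and> length ls \<le> N \<and>
                          distinct ls \<and> set ls \<subseteq> Lam \<rho> \<kappa> Y z v}.
        ennreal (cmod (div_diff h z v ls) * tau \<rho> z v \<bar>\<rho> z\<bar> ^ (length ls - 1)))"

definition circle_sup :: "(complex ^ 'n \<Rightarrow> real) \<Rightarrow> real \<Rightarrow> (complex ^ 'n \<Rightarrow> complex) \<Rightarrow> ennreal" where
  "circle_sup \<rho> \<kappa> h =
     (SUP z \<in> sublevel \<rho>. SUP v \<in> {v. norm v = 1}. SUP w \<in> bDisc z v (4 * \<kappa> * tau \<rho> z v \<bar>\<rho> z\<bar>).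
        ennreal (cmod (h w)))"

definition Linf_norm :: "(complex ^ 'n) set \<Rightarrow> (complex ^ 'n \<Rightarrow> complex) \<Rightarrow> ennreal" where
  "Linf_norm D h = esssup (lebesgue_on D) (\<lambda>z. ennreal (cmod (h z)))"

definition bounded_decomposition :: "(complex ^ 'n) set \<Rightarrow> (complex ^ 'n \<Rightarrow> complex) \<Rightarrow> (complex ^ 'n \<Rightarrow> complex)
    \<Rightarrow> (complex ^ 'n \<Rightarrow> complex) \<Rightarrow> (complex ^ 'n \<Rightarrow> complex) \<Rightarrow> (complex ^ 'n \<Rightarrow> complex) \<Rightarrow> bool" where
  "bounded_decomposition D f1 f2 g g1 g2 \<longleftrightarrow>
     holo_on g D \<and> holo_on g1 D \<and> holo_on g2 D \<and> bounded (g1 ` D) \<and> bounded (g2 ` D) \<and>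
     (\<forall>z\<in>D. g z = g1 z * f1 z + g2 z * f2 z)"

end

theory Submission
  imports Defs "HOL-Complex_Analysis.Complex_Analysis"
begin

text \<open>On \<open>X\<^sub>2 - X\<^sub>1\<close> the quotient \<open>g / f\<^sub>1\<close> equals \<open>g\<^sub>1\<close>, so its divided differences are Cauchy
  integrals of \<open>g\<^sub>1\<close> over a circle in the disc of radius \<open>\<tau> = \<tau>(z, v, \<bar>\<rho>(z)\<bar>)\<close>, which lies in \<open>D\<close>.
  The poles stay away from the circle of radius \<open>3\<tau>/4\<close> because
  \<open>\<tau>(z, v, 3\<kappa>\<bar>\<rho>(z)\<bar>) \<le> \<tau>/2\<close> for small \<open>\<kappa>\<close>: the second differences of \<open>\<rho>\<close> are comparable to the
  squared step, which gives the growth bound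
  \<open>\<rho>(z + 2u) - \<rho>(z) \<le> M (max (\<rho>(z + u)) (\<rho>(z - u)) - \<rho>(z))\<close>. On that circle \<open>g\<^sub>1\<close> is bounded by its
  supremum over \<open>D\<close>, and by the maximum principle this is the supremum over the circles of radius
  \<open>4\<kappa>\<tau>\<close>. The first estimate is the pointwise bound \<open>\<bar>g\<bar> \<le> (\<bar>g\<^sub>1\<bar> + \<bar>g\<^sub>2\<bar>) max(\<bar>f\<^sub>1\<bar>, \<bar>f\<^sub>2\<bar>)\<close>.\<close>

lemma Ck2D:
  assumes "Ck (Suc (Suc 0)) f"
  shows Ck2_differentiable: "f differentiable (at x)"
    and Ck2_frechet_differentiable: "(\<lambda>x. frechet_derivative f (at x) v) differentiable (at x)"
    and Ck2_continuous_hessian: "continuous_on UNIV (\<lambda>x. hessian f x v w)"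
  using assms by (auto simp: hessian_def)

lemma linear_hessian_right:
  assumes "Ck (Suc (Suc 0)) f"
  shows "linear (hessian f z v)"
  unfolding hessian_def [abs_def]
  by (rule linear_frechet_derivative) (rule Ck2_frechet_differentiable [OF assms])

lemma linear_hessian_left:
  assumes "Ck (Suc (Suc 0)) f"
  shows "linear (\<lambda>v. hessian f z v w)"
proof -
  let ?D = "\<lambda>v x. frechet_derivative f (at x) v"
  have lin: "linear (frechet_derivative f (at x))" for x
    by (rule linear_frechet_derivative) (rule Ck2_differentiable [OF assms])
  have d: "(?D v has_derivative frechet_derivative (?D v) (at z)) (at z)" for v
    using Ck2_frechet_differentiable [OF assms] frechet_derivative_works by blast
  show ?thesis
  proof
    fix v v'
    have "(?D (v + v') has_derivative (\<lambda>w. hessian f z v w + hessian f z v' w)) (at z)"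
      using has_derivative_add [OF d [of v] d [of v']] by (simp only: hessian_def linear_add [OF lin])
    from frechet_derivative_at [OF this]
    show "hessian f z (v + v') w = hessian f z v w + hessian f z v' w"
      by (simp add: hessian_def fun_eq_iff)
  next
    fix r v
    have "(?D (r *\<^sub>R v) has_derivative (\<lambda>w. r *\<^sub>R hessian f z v w)) (at z)"
      using has_derivative_scaleR_right [OF d [of v], of r] by (simp only: hessian_def linear_scale [OF lin])
    from frechet_derivative_at [OF this]
    show "hessian f z (r *\<^sub>R v) w = r *\<^sub>R hessian f z v w"
      by (simp add: hessian_def fun_eq_iff)
  qed
qed

lemma hessian_scaleR:
  assumes "Ck (Suc (Suc 0)) f"
  shows "hessian f z (r *\<^sub>R u) (r *\<^sub>R u) = r\<^sup>2 * hessian f z u u"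
  by (simp add: linear_scale [OF linear_hessian_right [OF assms]]
      linear_scale [OF linear_hessian_left [OF assms]] power2_eq_square)

lemma hessian_Basis_expansion:
  fixes f :: "'a::euclidean_space \<Rightarrow> real"
  assumes "Ck (Suc (Suc 0)) f"
  shows "hessian f z u u = (\<Sum>i\<in>Basis. \<Sum>j\<in>Basis. (u \<bullet> i) * ((u \<bullet> j) * hessian f z i j))"
proof -
  have right: "hessian f z i u = (\<Sum>j\<in>Basis. (u \<bullet> j) * hessian f z i j)" for i
    using linear_sum [OF linear_hessian_right [OF assms, of z i], of "\<lambda>j. (u \<bullet> j) *\<^sub>R j" Basis]
    by (simp add: euclidean_representation linear_scale [OF linear_hessian_right [OF assms]])
  have "hessian f z u u = (\<Sum>i\<in>Basis. (u \<bullet> i) * hessian f z i u)"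
    using linear_sum [OF linear_hessian_left [OF assms, of z u], of "\<lambda>i. (u \<bullet> i) *\<^sub>R i" Basis]
    by (simp add: euclidean_representation linear_scale [OF linear_hessian_left [OF assms]])
  also have "\<dots> = (\<Sum>i\<in>Basis. \<Sum>j\<in>Basis. (u \<bullet> i) * ((u \<bullet> j) * hessian f z i j))"
    by (simp add: right sum_distrib_left)
  finally show ?thesis .
qed

lemma hessian_bounds_on_compact:
  fixes f :: "'a::euclidean_space \<Rightarrow> real"
  assumes f: "Ck (Suc (Suc 0)) f" and pos: "\<And>z w. w \<noteq> 0 \<Longrightarrow> hessian f z w w > 0"
    and K: "compact K"
  obtains c C where "0 < c" "0 < C"
    "\<And>z u. z \<in> K \<Longrightarrow> c * (norm u)\<^sup>2 \<le> hessian f z u u"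
    "\<And>z u. z \<in> K \<Longrightarrow> hessian f z u u \<le> C * (norm u)\<^sup>2"
proof (cases "K = {}")
  case True
  then show ?thesis
    using that [of 1 1] by auto
next
  case False
  define S where "S = K \<times> sphere (0::'a) 1"
  define H where "H = (\<lambda>p. hessian f (fst p) (snd p) (snd p))"
  have cH: "continuous_on UNIV (\<lambda>p::'a \<times> 'a. hessian f (fst p) i j)" for i j
    using continuous_on_compose2 [OF Ck2_continuous_hessian [OF f, of i j] continuous_on_fst [OF continuous_on_id]]
    by auto
  have "continuous_on UNIV H"
    unfolding H_def hessian_Basis_expansion [OF f] by (intro continuous_intros cH)
  then have cont: "continuous_on S H"
    using continuous_on_subset by blast
  have comp: "compact S"
    unfolding S_def using K by (intro compact_Times) auto
  have ne: "S \<noteq> {}"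
    using False by (simp add: S_def)
  obtain p where p: "p \<in> S" "\<And>q. q \<in> S \<Longrightarrow> H p \<le> H q"
    using continuous_attains_inf [OF comp ne cont] by blast
  obtain p' where p': "p' \<in> S" "\<And>q. q \<in> S \<Longrightarrow> H q \<le> H p'"
    using continuous_attains_sup [OF comp ne cont] by blast
  have Hpos: "0 < H p"
    unfolding H_def using p(1) by (intro pos) (auto simp: S_def)
  have hom: "hessian f z u u = (norm u)\<^sup>2 * H (z, sgn u)" for z u
    using hessian_scaleR [OF f, of z "norm u" "sgn u"]
    by (cases "u = 0") (auto simp: H_def sgn_div_norm)
  have mem: "u \<noteq> 0 \<Longrightarrow> z \<in> K \<Longrightarrow> (z, sgn u) \<in> S" for z u
    by (simp add: S_def norm_sgn)
  have "H p * (norm u)\<^sup>2 \<le> hessian f z u u \<and> hessian f z u u \<le> H p' * (norm u)\<^sup>2" if "z \<in> K" for z u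
    using p(2) [OF mem [OF _ that]] p'(2) [OF mem [OF _ that]]
    by (cases "u = 0") (auto simp: hom mult.commute mult_right_mono)
  with that [of "H p" "H p'"] Hpos p'(2) [OF p(1)] show ?thesis
    by auto
qed

lemma Taylor_hessian:
  fixes f :: "'a::real_normed_vector \<Rightarrow> real"
  assumes f: "Ck (Suc (Suc 0)) f"
  obtains s where "s \<in> closed_segment x (x + u)"
    "f (x + u) = f x + frechet_derivative f (at x) u + hessian f s u u / 2"
proof -
  define diff where "diff = (\<lambda>(m::nat) t. if m = 0 then f (x + t *\<^sub>R u)
    else if m = 1 then frechet_derivative f (at (x + t *\<^sub>R u)) u else hessian f (x + t *\<^sub>R u) u u)"
  have line: "((\<lambda>t. x + t *\<^sub>R u) has_derivative (\<lambda>h. h *\<^sub>R u)) (at t)" for t :: real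
    by (auto intro!: derivative_eq_intros)
  have chain: "((\<lambda>t. g (x + t *\<^sub>R u)) has_real_derivative frechet_derivative g (at (x + t *\<^sub>R u)) u) (at t)"
    if g: "\<And>y. g differentiable (at y)" for g :: "'a \<Rightarrow> real" and t :: real
  proof -
    let ?D = "frechet_derivative g (at (x + t *\<^sub>R u))"
    have d: "(g has_derivative ?D) (at (x + t *\<^sub>R u))"
      using g frechet_derivative_works by blast
    have "((\<lambda>t. g (x + t *\<^sub>R u)) has_derivative (\<lambda>h. ?D (h *\<^sub>R u))) (at t)"
      by (rule has_derivative_compose [OF line d])
    then show ?thesis
      by (simp add: has_field_derivative_def linear_scale [OF has_derivative_linear [OF d]] mult.commute [of _ "?D u"])
  qed
  have "\<forall>m t. m < 2 \<and> 0 \<le> t \<and> t \<le> 1 \<longrightarrow> DERIV (diff m) t :> diff (Suc m) t"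
  proof (intro allI impI)
    fix m :: nat and t :: real
    assume "m < 2 \<and> 0 \<le> t \<and> t \<le> 1"
    then consider "m = 0" | "m = 1"
      by linarith
    then show "DERIV (diff m) t :> diff (Suc m) t"
    proof cases
      case 1
      then show ?thesis
        using chain [OF Ck2_differentiable [OF f]] by (simp add: diff_def)
    next
      case 2
      then show ?thesis
        using chain [OF Ck2_frechet_differentiable [OF f]] by (simp add: diff_def hessian_def)
    qed
  qed
  from Taylor_up [of 2 diff "diff 0" 0 1 0, OF _ _ this]
  obtain t where t: "0 < t" "t < 1" "diff 0 1 = (\<Sum>m<2. (diff m 0 / fact m) * (1 - 0)^m) + (diff 2 t / fact 2) * (1 - 0)^2"
    by auto
  show thesis
  proof (rule that)
    show "x + t *\<^sub>R u \<in> closed_segment x (x + u)"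
      using t by (auto simp: in_segment algebra_simps intro!: exI [of _ t])
    show "f (x + u) = f x + frechet_derivative f (at x) u + hessian f (x + t *\<^sub>R u) u u / 2"
      using t(3) by (simp add: diff_def numeral_2_eq_2)
  qed
qed

lemma second_difference_bounds:
  fixes f :: "'a::euclidean_space \<Rightarrow> real"
  assumes f: "smooth_strictly_convex f" and K: "compact K" "convex K"
  obtains c C where "0 < c" "0 < C"
    "\<And>x u. x + u \<in> K \<Longrightarrow> x - u \<in> K \<Longrightarrow> c * (norm u)\<^sup>2 \<le> f (x + u) + f (x - u) - 2 * f x"
    "\<And>x u. x + u \<in> K \<Longrightarrow> x - u \<in> K \<Longrightarrow> f (x + u) + f (x - u) - 2 * f x \<le> C * (norm u)\<^sup>2"
proof -
  have f2: "Ck (Suc (Suc 0)) f" and pos: "\<And>z w. w \<noteq> 0 \<Longrightarrow> hessian f z w w > 0"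
    using f by (auto simp: smooth_strictly_convex_def smooth_def simp del: Ck.simps)
  obtain c C where cC: "0 < c" "0 < C"
    "\<And>z u. z \<in> K \<Longrightarrow> c * (norm u)\<^sup>2 \<le> hessian f z u u"
    "\<And>z u. z \<in> K \<Longrightarrow> hessian f z u u \<le> C * (norm u)\<^sup>2"
    using hessian_bounds_on_compact [OF f2 pos K(1)] by metis
  have "c * (norm u)\<^sup>2 \<le> f (x + u) + f (x - u) - 2 * f x \<and>
        f (x + u) + f (x - u) - 2 * f x \<le> C * (norm u)\<^sup>2"
    if xu: "x + u \<in> K" "x - u \<in> K" for x u
  proof -
    have x: "x \<in> K"
      using convexD [OF K(2) xu, of "1/2" "1/2"] by (simp add: algebra_simps flip: scaleR_add_left)
    obtain s where s: "s \<in> closed_segment x (x + u)"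
      "f (x + u) = f x + frechet_derivative f (at x) u + hessian f s u u / 2"
      by (rule Taylor_hessian [OF f2])
    obtain t where t: "t \<in> closed_segment x (x + - u)"
      "f (x + - u) = f x + frechet_derivative f (at x) (- u) + hessian f t (- u) (- u) / 2"
      by (rule Taylor_hessian [OF f2])
    have "linear (frechet_derivative f (at x))"
      by (rule linear_frechet_derivative) (rule Ck2_differentiable [OF f2])
    then have "f (x + u) + f (x - u) - 2 * f x = (hessian f s u u + hessian f t u u) / 2"
      using s(2) t(2) hessian_scaleR [OF f2, of t "-1" u] by (simp add: linear_neg)
    moreover have "s \<in> K" "t \<in> K"
      using s(1) t(1) x xu K(2) closed_segment_subset by fastforce+
    ultimately show ?thesis
      using cC(3,4) [of s u] cC(3,4) [of t u] by simp
  qed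
  with that [of c C] cC(1,2) show ?thesis
    by blast
qed

lemma doubling:
  fixes f :: "'a::euclidean_space \<Rightarrow> real"
  assumes f: "smooth_strictly_convex f" and K: "compact K" "convex K"
  obtains M where "1 \<le> M"
    "\<And>x u. x + 2 *\<^sub>R u \<in> K \<Longrightarrow> x - 2 *\<^sub>R u \<in> K \<Longrightarrow>
       f (x + 2 *\<^sub>R u) - f x \<le> M * (max (f (x + u)) (f (x - u)) - f x)"
proof -
  obtain c C where cC: "0 < c" "0 < C"
    "\<And>x u. x + u \<in> K \<Longrightarrow> x - u \<in> K \<Longrightarrow> c * (norm u)\<^sup>2 \<le> f (x + u) + f (x - u) - 2 * f x"
    "\<And>x u. x + u \<in> K \<Longrightarrow> x - u \<in> K \<Longrightarrow> f (x + u) + f (x - u) - 2 * f x \<le> C * (norm u)\<^sup>2"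
    using second_difference_bounds [OF f K] by metis
  have "f (x + 2 *\<^sub>R u) - f x \<le> (2 + 2 * C / c) * (max (f (x + u)) (f (x - u)) - f x)"
    if xu: "x + 2 *\<^sub>R u \<in> K" "x - 2 *\<^sub>R u \<in> K" for x u
  proof -
    define m where "m = max (f (x + u)) (f (x - u)) - f x"
    have comb: "(1/2) *\<^sub>R (x + 2 *\<^sub>R u) + (1/2) *\<^sub>R (x - 2 *\<^sub>R u) = x"
      "(3/4) *\<^sub>R (x + 2 *\<^sub>R u) + (1/4) *\<^sub>R (x - 2 *\<^sub>R u) = x + u"
      "(1/4) *\<^sub>R (x + 2 *\<^sub>R u) + (3/4) *\<^sub>R (x - 2 *\<^sub>R u) = x - u"
      by (rule euclidean_eqI; simp add: inner_simps field_simps)+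
    have *: "x \<in> K" "x + u \<in> K" "x - u \<in> K"
      using convexD [OF K(2) xu, of "1/2" "1/2"] convexD [OF K(2) xu, of "3/4" "1/4"]
        convexD [OF K(2) xu, of "1/4" "3/4"]
      unfolding comb by simp_all
    have m: "f (x + u) - f x \<le> m" "f (x - u) - f x \<le> m"
      by (simp_all add: m_def)
    have "c * (norm u)\<^sup>2 \<le> 2 * m"
      using cC(3) [of x u] * m by linarith
    then have "(norm u)\<^sup>2 \<le> 2 * m / c"
      using cC(1) by (simp add: field_simps)
    then have "C * (norm u)\<^sup>2 \<le> C * (2 * m / c)"
      using cC(2) by (intro mult_left_mono) auto
    moreover have "f (x + 2 *\<^sub>R u) + f x - 2 * f (x + u) \<le> C * (norm u)\<^sup>2"
      using cC(4) [of "x + u" u] xu * by (simp add: scaleR_2 add.assoc)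
    ultimately have "f (x + 2 *\<^sub>R u) - f x \<le> 2 * m + C * (2 * m / c)"
      using m(1) by linarith
    then show ?thesis
      unfolding m_def [symmetric] by (simp add: algebra_simps)
  qed
  moreover have "1 \<le> 2 + 2 * C / c"
    using cC by (simp add: add_increasing2)
  ultimately show ?thesis
    using that by blast
qed

lemma has_derivative_complex_line:
  "((\<lambda>l. z + l *s v) has_derivative (\<lambda>a. a *s v)) (at l within S)" for z v :: "complex ^ 'n"
proof -
  have "bounded_linear (\<lambda>a. a *s v)"
    by (intro linear_conv_bounded_linear [THEN iffD1] linearI)
      (simp_all add: vec_eq_iff distrib_right)
  then have "((\<lambda>a. a *s v) has_derivative (\<lambda>a. a *s v)) (at l within S)"
    by (rule bounded_linear_imp_has_derivative)
  from has_derivative_add [OF has_derivative_const this, of z] show ?thesis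
    by simp
qed

lemma norm_vector_scalar_mult: "norm (l *s v) = cmod l * norm v" for v :: "complex ^ 'n"
  by (simp add: norm_vec_def norm_mult L2_set_right_distrib)

lemma holo_on_complex_line:
  fixes z v :: "complex ^ 'n"
  assumes h: "holo_on h D" and S: "\<And>l. l \<in> S \<Longrightarrow> z + l *s v \<in> D"
  shows "(\<lambda>l. h (z + l *s v)) holomorphic_on S"
proof
  fix l assume "l \<in> S"
  with h S obtain h' where h': "(h has_derivative h') (at (z + l *s v))" "\<And>a w. h' (a *s w) = a * h' w"
    unfolding holo_on_def by blast
  have "((\<lambda>l. h (z + l *s v)) has_derivative (\<lambda>a. h' (a *s v))) (at l within S)"
    by (rule has_derivative_compose [OF has_derivative_complex_line h'(1)])
  then have "((\<lambda>l. h (z + l *s v)) has_field_derivative h' v) (at l within S)"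
    by (simp add: has_field_derivative_def h'(2) mult.commute [of _ "h' v"])
  then show "(\<lambda>l. h (z + l *s v)) field_differentiable at l within S"
    using field_differentiable_def by blast
qed

lemma holo_on_imp_continuous_on: "holo_on h D \<Longrightarrow> continuous_on D h"
  unfolding holo_on_def
  by (meson continuous_at_imp_continuous_on has_derivative_continuous)

lemma div_diff_cong:
  "(\<And>l. l \<in> set ls \<Longrightarrow> h (z + l *s v) = h' (z + l *s v)) \<Longrightarrow> div_diff h z v ls = div_diff h' z v ls"
proof (induction h z v ls rule: div_diff.induct)
  case (3 h z v l m ls)
  have "div_diff h z v (butlast (l # m # ls)) = div_diff h' z v (butlast (l # m # ls))"
    by (rule 3(1)) (meson 3(3) in_set_butlastD)
  moreover have "div_diff h z v (m # ls) = div_diff h' z v (m # ls)"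
    by (rule 3(2)) (simp add: 3(3))
  ultimately show ?case
    by simp
qed auto

text \<open>For the integrand, taking differences and dividing by \<open>\<lambda>\<^sub>1 - \<lambda>\<^sub>k\<close> turns
  \<open>h / (\<Prod>i<k. \<zeta> - \<lambda>\<^sub>i)\<close> and \<open>h / (\<Prod>1<i\<le>k. \<zeta> - \<lambda>\<^sub>i)\<close> into \<open>h / (\<Prod>i\<le>k. \<zeta> - \<lambda>\<^sub>i)\<close>.\<close>
lemma div_diff_Cauchy:
  assumes "continuous_on (cball 0 r) (\<lambda>l. h (z + l *s v))" "(\<lambda>l. h (z + l *s v)) holomorphic_on ball 0 r"
    "ls \<noteq> []" "distinct ls" "\<And>l. l \<in> set ls \<Longrightarrow> cmod l < r"
  shows "((\<lambda>\<zeta>. h (z + \<zeta> *s v) / (\<Prod>l\<leftarrow>ls. \<zeta> - l)) has_contour_integral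
            2 * of_real pi * \<i> * div_diff h z v ls) (circlepath 0 r)"
  using assms
proof (induction h z v ls rule: div_diff.induct)
  case (2 h z v l)
  then show ?case
    using Cauchy_integral_circlepath [of 0 r "\<lambda>l. h (z + l *s v)" l] by simp
next
  case (3 h z v l m ls)
  define xs where "xs = butlast (m # ls)"
  define k where "k = last (m # ls)"
  have mls: "m # ls = xs @ [k]"
    by (simp add: xs_def k_def)
  have but: "butlast (l # m # ls) = l # xs"
    by (simp add: xs_def)
  have dd: "div_diff h z v (l # m # ls) = (div_diff h z v (l # xs) - div_diff h z v (xs @ [k])) / (l - k)"
    unfolding div_diff.simps(3) but k_def [symmetric] unfolding mls ..
  have dist: "distinct (l # xs @ [k])" and sub: "\<And>x. x \<in> set (l # xs @ [k]) \<Longrightarrow> cmod x < r"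
    using 3(6,7) unfolding mls by auto
  let ?h = "\<lambda>\<zeta>. h (z + \<zeta> *s v)"
  have A: "((\<lambda>\<zeta>. ?h \<zeta> / (\<Prod>l\<leftarrow>l # xs. \<zeta> - l)) has_contour_integral
      2 * of_real pi * \<i> * div_diff h z v (l # xs)) (circlepath 0 r)"
    using 3(1) [unfolded but] 3(3,4) dist sub by auto
  have B: "((\<lambda>\<zeta>. ?h \<zeta> / (\<Prod>l\<leftarrow>xs @ [k]. \<zeta> - l)) has_contour_integral
      2 * of_real pi * \<i> * div_diff h z v (xs @ [k])) (circlepath 0 r)"
    using 3(2) [unfolded mls] 3(3,4) dist sub by auto
  have lk: "l \<noteq> k"
    using dist by auto
  have r: "0 < r"
    using order_le_less_trans [OF norm_ge_zero sub [of l]] by simp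
  have "((\<lambda>\<zeta>. (?h \<zeta> / (\<Prod>l\<leftarrow>l # xs. \<zeta> - l) - ?h \<zeta> / (\<Prod>l\<leftarrow>xs @ [k]. \<zeta> - l)) / (l - k))
      has_contour_integral (2 * of_real pi * \<i> * div_diff h z v (l # xs)
        - 2 * of_real pi * \<i> * div_diff h z v (xs @ [k])) / (l - k)) (circlepath 0 r)"
    by (intro has_contour_integral_div has_contour_integral_diff A B)
  also have "(2 * of_real pi * \<i> * div_diff h z v (l # xs)
        - 2 * of_real pi * \<i> * div_diff h z v (xs @ [k])) / (l - k)
      = 2 * of_real pi * \<i> * div_diff h z v (l # m # ls)"
    unfolding dd by (simp add: right_diff_distrib)
  finally have C: "((\<lambda>\<zeta>. (?h \<zeta> / (\<Prod>l\<leftarrow>l # xs. \<zeta> - l) - ?h \<zeta> / (\<Prod>l\<leftarrow>xs @ [k]. \<zeta> - l)) / (l - k))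
      has_contour_integral 2 * of_real pi * \<i> * div_diff h z v (l # m # ls)) (circlepath 0 r)" .
  show ?case
  proof (rule has_contour_integral_eq [OF C])
    fix \<zeta> assume "\<zeta> \<in> path_image (circlepath 0 r)"
    then have "cmod \<zeta> = r"
      using r by (simp add: dist_norm)
    then have "\<zeta> \<noteq> x" if "x \<in> set (l # xs @ [k])" for x
      using sub [OF that] by auto
    then have "\<zeta> - l \<noteq> 0" "\<zeta> - k \<noteq> 0" and P: "(\<Prod>l\<leftarrow>xs. \<zeta> - l) \<noteq> 0"
      by (auto simp: prod_list_zero_iff)
    define P where "P = (\<Prod>l\<leftarrow>xs. \<zeta> - l)"
    have "(?h \<zeta> / ((\<zeta> - l) * P) - ?h \<zeta> / (P * (\<zeta> - k))) / (l - k) = ?h \<zeta> / ((\<zeta> - l) * (P * (\<zeta> - k)))"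
      using \<open>\<zeta> - l \<noteq> 0\<close> \<open>\<zeta> - k \<noteq> 0\<close> P lk unfolding P_def [symmetric]
      by (simp add: divide_simps) (simp add: algebra_simps)
    then show "(?h \<zeta> / (\<Prod>l\<leftarrow>l # xs. \<zeta> - l) - ?h \<zeta> / (\<Prod>l\<leftarrow>xs @ [k]. \<zeta> - l)) / (l - k)
        = ?h \<zeta> / (\<Prod>l\<leftarrow>l # m # ls. \<zeta> - l)"
      unfolding mls P_def by simp
  qed
qed auto

lemma prod_list_norm_lower_bound:
  fixes \<zeta> :: complex
  assumes "0 \<le> d" "\<And>l. l \<in> set ls \<Longrightarrow> d \<le> cmod (\<zeta> - l)"
  shows "d ^ length ls \<le> cmod (\<Prod>l\<leftarrow>ls. \<zeta> - l)"
  using assms by (induction ls) (auto simp: norm_mult intro!: mult_mono)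

lemma div_diff_bound:
  assumes cont: "continuous_on (cball 0 r) (\<lambda>l. h (z + l *s v))"
    and hol: "(\<lambda>l. h (z + l *s v)) holomorphic_on ball 0 r"
    and ls: "ls \<noteq> []" "distinct ls" "\<And>l. l \<in> set ls \<Longrightarrow> cmod l \<le> s"
    and s: "0 \<le> s" "s < r"
    and B: "\<And>l. cmod l = r \<Longrightarrow> cmod (h (z + l *s v)) \<le> B"
  shows "cmod (div_diff h z v ls) \<le> B / (r - s) ^ length ls * r"
proof -
  have B0: "0 \<le> B"
    using B [of "of_real r"] s by (smt (verit) norm_ge_zero norm_of_real)
  have "cmod (2 * of_real pi * \<i> * div_diff h z v ls) \<le> B / (r - s) ^ length ls * (2 * pi * r)"
  proof (rule has_contour_integral_bound_circlepath)
    show "((\<lambda>\<zeta>. h (z + \<zeta> *s v) / (\<Prod>l\<leftarrow>ls. \<zeta> - l)) has_contour_integral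
            2 * of_real pi * \<i> * div_diff h z v ls) (circlepath 0 r)"
      using div_diff_Cauchy [OF cont hol ls(1,2)] ls(3) s by fastforce
    fix \<zeta> :: complex assume "cmod (\<zeta> - 0) = r"
    then have \<zeta>: "cmod \<zeta> = r"
      by simp
    have "r - s \<le> cmod (\<zeta> - l)" if "l \<in> set ls" for l
      using ls(3) [OF that] norm_triangle_ineq2 [of \<zeta> l] \<zeta> by linarith
    then have "(r - s) ^ length ls \<le> cmod (\<Prod>l\<leftarrow>ls. \<zeta> - l)"
      using s by (intro prod_list_norm_lower_bound) auto
    then show "cmod (h (z + \<zeta> *s v) / (\<Prod>l\<leftarrow>ls. \<zeta> - l)) \<le> B / (r - s) ^ length ls"
      unfolding norm_divide using B [OF \<zeta>] B0 s by (intro frac_le) auto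
  qed (use s B0 in auto)
  then have "(2 * pi) * cmod (div_diff h z v ls) \<le> (2 * pi) * (B / (r - s) ^ length ls * r)"
    by (simp add: norm_mult mult_ac)
  then show ?thesis
    by (subst (asm) mult_le_cancel_left_pos) auto
qed

lemma open_sublevel: "continuous_on UNIV \<rho> \<Longrightarrow> open (sublevel \<rho>)"
  unfolding sublevel_def by (intro open_Collect_less) (auto intro: continuous_intros)

lemma strictly_convex_domain_continuous:
  "strictly_convex_domain \<rho> \<Longrightarrow> continuous_on UNIV \<rho>"
  unfolding strictly_convex_domain_def smooth_strictly_convex_def smooth_def
  by (metis Ck.simps(1))

definition tau_set :: "(complex ^ 'n \<Rightarrow> real) \<Rightarrow> complex ^ 'n \<Rightarrow> complex ^ 'n \<Rightarrow> real \<Rightarrow> real set" where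
  "tau_set \<rho> z v \<epsilon> = {t. t > 0 \<and> (\<forall>l::complex. cmod l < t \<longrightarrow> \<rho> (z + l *s v) - \<rho> z < \<epsilon>)}"

lemma tau_eq: "tau \<rho> z v \<epsilon> = Sup (tau_set \<rho> z v \<epsilon>)"
  by (simp add: tau_def tau_set_def)

lemma tau_set_nonempty:
  assumes "continuous_on UNIV \<rho>" "norm v = 1" "\<epsilon> > 0"
  shows "tau_set \<rho> z v \<epsilon> \<noteq> {}"
proof -
  have "isCont \<rho> z"
    using assms(1) continuous_on_eq_continuous_at by blast
  then obtain d where d: "d > 0" "\<And>y. dist y z < d \<Longrightarrow> dist (\<rho> y) (\<rho> z) < \<epsilon>"
    using assms(3) by (auto simp: continuous_at_eps_delta)
  have "\<rho> (z + l *s v) - \<rho> z < \<epsilon>" if "cmod l < d" for l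
    using d(2) [of "z + l *s v"] that assms(2)
    by (auto simp: dist_norm norm_vector_scalar_mult)
  with d(1) show ?thesis
    unfolding tau_set_def by auto
qed

lemma tau_set_bdd_above:
  assumes "sublevel \<rho> \<subseteq> ball 0 R" "z \<in> sublevel \<rho>" "norm v = 1" "\<epsilon> \<le> \<bar>\<rho> z\<bar>"
  shows "bdd_above (tau_set \<rho> z v \<epsilon>)"
proof (rule bdd_aboveI)
  fix t assume t: "t \<in> tau_set \<rho> z v \<epsilon>"
  show "t \<le> 2 * R"
  proof (rule ccontr)
    assume "\<not> t \<le> 2 * R"
    moreover have "norm z < R"
      using assms(1,2) by auto
    then have "0 < R"
      using norm_ge_zero order_le_less_trans by blast
    ultimately have l: "cmod (of_real (2 * R)) < t"
      by simp
    have "\<rho> (z + of_real (2 * R) *s v) - \<rho> z < \<epsilon>"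
      using l t unfolding tau_set_def by blast
    then have "z + of_real (2 * R) *s v \<in> sublevel \<rho>"
      using assms(2,4) by (simp add: sublevel_def)
    then have "norm (z + of_real (2 * R) *s v) < R" "norm z < R"
      using assms(1,2) by auto
    moreover have "norm (of_real (2 * R) *s v) \<le> norm (z + of_real (2 * R) *s v) + norm z"
      using norm_triangle_ineq4 [of "z + of_real (2 * R) *s v" z] by simp
    ultimately show False
      unfolding norm_vector_scalar_mult norm_of_real assms(3) by linarith
  qed
qed

lemma less_tau_imp:
  assumes "continuous_on UNIV \<rho>" "norm v = 1" "\<epsilon> > 0" "cmod l < tau \<rho> z v \<epsilon>"
  shows "\<rho> (z + l *s v) - \<rho> z < \<epsilon>"
  using less_cSupE [OF assms(4) [unfolded tau_eq] tau_set_nonempty [OF assms(1-3)]]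
  by (auto simp: tau_set_def)

lemma tau_pos:
  assumes "continuous_on UNIV \<rho>" "sublevel \<rho> \<subseteq> ball 0 R" "z \<in> sublevel \<rho>" "norm v = 1" "0 < \<epsilon>" "\<epsilon> \<le> \<bar>\<rho> z\<bar>"
  shows "0 < tau \<rho> z v \<epsilon>"
proof -
  obtain t where t: "t \<in> tau_set \<rho> z v \<epsilon>"
    using tau_set_nonempty [OF assms(1,4,5)] by blast
  then have "0 < t" "t \<le> tau \<rho> z v \<epsilon>"
    using cSup_upper [OF t tau_set_bdd_above [OF assms(2,3,4,6)]] by (auto simp: tau_eq tau_set_def)
  then show ?thesis
    by simp
qed

lemma less_tau_imp_sublevel:
  assumes "continuous_on UNIV \<rho>" "z \<in> sublevel \<rho>" "norm v = 1" "cmod l < tau \<rho> z v \<bar>\<rho> z\<bar>"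
  shows "z + l *s v \<in> sublevel \<rho>"
  using less_tau_imp [OF assms(1,3) _ assms(4)] assms(2) by (auto simp: sublevel_def)

lemma tau_half:
  fixes \<rho> :: "complex ^ 'n \<Rightarrow> real"
  assumes "strictly_convex_domain \<rho>"
  obtains \<kappa>0 where "0 < \<kappa>0" "\<kappa>0 \<le> 1/4"
    "\<And>\<kappa> z v. 0 < \<kappa> \<Longrightarrow> \<kappa> < \<kappa>0 \<Longrightarrow> z \<in> sublevel \<rho> \<Longrightarrow> norm v = 1 \<Longrightarrow>
       2 * tau \<rho> z v (3 * \<kappa> * \<bar>\<rho> z\<bar>) \<le> tau \<rho> z v \<bar>\<rho> z\<bar>"
proof -
  have ssc: "smooth_strictly_convex \<rho>" and cont: "continuous_on UNIV \<rho>"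
    using assms strictly_convex_domain_continuous by (auto simp: strictly_convex_domain_def)
  obtain R where R: "sublevel \<rho> \<subseteq> ball 0 R"
    using assms bounded_subset_ballD [of "sublevel \<rho>" 0] by (auto simp: strictly_convex_domain_def)
  obtain M where M: "1 \<le> M"
    "\<And>x u. x + 2 *\<^sub>R u \<in> cball 0 (3 * R) \<Longrightarrow> x - 2 *\<^sub>R u \<in> cball 0 (3 * R) \<Longrightarrow>
       \<rho> (x + 2 *\<^sub>R u) - \<rho> x \<le> M * (max (\<rho> (x + u)) (\<rho> (x - u)) - \<rho> x)"
    using doubling [OF ssc compact_cball convex_cball] by metis
  show ?thesis
  proof (rule that)
    show "0 < 1 / (4 * M)" "1 / (4 * M) \<le> 1/4"
      using M(1) by (auto simp: field_simps)
    fix \<kappa> z v assume \<kappa>: "0 < \<kappa>" "\<kappa> < 1 / (4 * M)" and z: "z \<in> sublevel \<rho>" and v: "norm (v::complex^'n) = 1"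
    define \<epsilon> where "\<epsilon> = 3 * \<kappa> * \<bar>\<rho> z\<bar>"
    have \<rho>z: "\<rho> z < 0"
      using z by (simp add: sublevel_def)
    have "M * (3 * \<kappa>) < 1"
      using \<kappa> M(1) by (simp add: field_simps)
    then have M\<epsilon>: "M * \<epsilon> < \<bar>\<rho> z\<bar>"
      using \<rho>z mult_strict_right_mono [of "M * (3 * \<kappa>)" 1 "\<bar>\<rho> z\<bar>"] by (simp add: \<epsilon>_def mult.assoc)
    have \<epsilon>: "0 < \<epsilon>"
      using \<kappa>(1) \<rho>z by (simp add: \<epsilon>_def mult_pos_neg)
    have \<epsilon>le: "\<epsilon> \<le> \<bar>\<rho> z\<bar>"
      using M\<epsilon> M(1) \<epsilon> mult_right_mono [of 1 M \<epsilon>] by linarith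
    have "\<rho> (z + l *s v) - \<rho> z < \<bar>\<rho> z\<bar>" if l: "cmod l < 2 * tau \<rho> z v \<epsilon>" for l
    proof -
      define u where "u = (l / 2) *s v"
      have u2: "2 *\<^sub>R u = l *s v"
        by (simp add: u_def vec_eq_iff scaleR_conv_of_real)
      have half: "cmod (l / 2) < tau \<rho> z v \<epsilon>" "cmod (- (l / 2)) < tau \<rho> z v \<epsilon>"
        using l by (simp_all add: norm_divide)
      have minus: "z + (- (l / 2)) *s v = z - u"
        by (simp add: u_def vec_eq_iff)
      have lt: "\<rho> (z + u) - \<rho> z < \<epsilon>" "\<rho> (z - u) - \<rho> z < \<epsilon>"
        using less_tau_imp [OF cont v \<epsilon> half(1)] less_tau_imp [OF cont v \<epsilon> half(2)]
        unfolding minus by (simp_all add: u_def)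
      then have "z + u \<in> sublevel \<rho>" "z - u \<in> sublevel \<rho>"
        using \<epsilon>le \<rho>z by (auto simp: sublevel_def)
      then have n: "norm (z + u) < R" "norm (z - u) < R" "norm z < R"
        using R z by auto
      have e: "z + 2 *\<^sub>R u = (z + u) + (z + u) - z" "z - 2 *\<^sub>R u = (z - u) + (z - u) - z"
        by (simp_all add: scaleR_2)
      have "norm (z + 2 *\<^sub>R u) \<le> 3 * R" "norm (z - 2 *\<^sub>R u) \<le> 3 * R"
        unfolding e
        using norm_triangle_ineq4 [of "(z + u) + (z + u)" z] norm_triangle_ineq [of "z + u" "z + u"]
          norm_triangle_ineq4 [of "(z - u) + (z - u)" z] norm_triangle_ineq [of "z - u" "z - u"] n
        by linarith+
      then have "\<rho> (z + 2 *\<^sub>R u) - \<rho> z \<le> M * (max (\<rho> (z + u)) (\<rho> (z - u)) - \<rho> z)"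
        by (intro M(2)) auto
      also have "\<dots> \<le> M * \<epsilon>"
        using lt M(1) by (intro mult_left_mono) auto
      finally show ?thesis
        using M\<epsilon> u2 by simp
    qed
    moreover have "0 < tau \<rho> z v \<epsilon>"
      by (rule tau_pos [OF cont R z v \<epsilon> \<epsilon>le])
    ultimately have "2 * tau \<rho> z v \<epsilon> \<in> tau_set \<rho> z v \<bar>\<rho> z\<bar>"
      by (simp add: tau_set_def)
    then show "2 * tau \<rho> z v (3 * \<kappa> * \<bar>\<rho> z\<bar>) \<le> tau \<rho> z v \<bar>\<rho> z\<bar>"
      unfolding tau_eq \<epsilon>_def [symmetric]
      by (rule cSup_upper) (rule tau_set_bdd_above [OF R z v order.refl])
  qed
qed

text \<open>The circles in \<^const>\<open>circle_sup\<close> need not surround the points of \<^const>\<open>Lam\<close>: in complex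
  tangential directions \<open>\<tau>(z, v, 3\<kappa>\<bar>\<rho>(z)\<bar>)\<close> is of order \<open>\<surd>\<kappa> \<tau>(z, v, \<bar>\<rho>(z)\<bar>)\<close>. But
  by the maximum principle the supremum over all circles is the supremum over the whole domain.\<close>
lemma norm_le_circle_sup:
  fixes \<rho> :: "complex ^ 'n \<Rightarrow> real"
  assumes \<rho>: "strictly_convex_domain \<rho>" and \<kappa>: "0 < \<kappa>" "\<kappa> < 1/4"
    and h: "holo_on h (sublevel \<rho>)" and z: "z \<in> sublevel \<rho>"
  shows "ennreal (cmod (h z)) \<le> circle_sup \<rho> \<kappa> h"
proof (cases "circle_sup \<rho> \<kappa> h")
  case (real B)
  have cont: "continuous_on UNIV \<rho>"
    using \<rho> by (rule strictly_convex_domain_continuous)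
  obtain R where R: "sublevel \<rho> \<subseteq> ball 0 R"
    using \<rho> bounded_subset_ballD [of "sublevel \<rho>" 0] by (auto simp: strictly_convex_domain_def)
  obtain v :: "complex ^ 'n" where v: "norm v = 1"
    using vector_choose_size [of 1] by auto
  define T where "T = tau \<rho> z v \<bar>\<rho> z\<bar>"
  have "\<rho> z < 0"
    using z by (simp add: sublevel_def)
  then have T: "0 < T"
    unfolding T_def using tau_pos [OF cont R z v] by simp
  have r: "0 < 4 * \<kappa> * T" "4 * \<kappa> * T < T"
    using \<kappa> T by auto
  have D: "z + l *s v \<in> sublevel \<rho>" if "l \<in> cball 0 (4 * \<kappa> * T)" for l :: complex
    using less_tau_imp_sublevel [OF cont z v, of l] that r by (simp add: T_def)
  have hol: "(\<lambda>l. h (z + l *s v)) holomorphic_on cball 0 (4 * \<kappa> * T)"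
    by (rule holo_on_complex_line [OF h D])
  have "cmod (h (z + 0 *s v)) \<le> B"
  proof (rule maximum_modulus_frontier [where S = "cball (0::complex) (4 * \<kappa> * T)" and f = "\<lambda>l. h (z + l *s v)"])
    show "(\<lambda>l. h (z + l *s v)) holomorphic_on interior (cball 0 (4 * \<kappa> * T))"
      using hol holomorphic_on_subset interior_subset by blast
    show "continuous_on (closure (cball 0 (4 * \<kappa> * T))) (\<lambda>l. h (z + l *s v))"
      using holomorphic_on_imp_continuous_on [OF hol] by simp
    fix l :: complex assume "l \<in> frontier (cball 0 (4 * \<kappa> * T))"
    then have "z + l *s v \<in> bDisc z v (4 * \<kappa> * T)"
      by (auto simp: bDisc_def)
    then have "ennreal (cmod (h (z + l *s v))) \<le> circle_sup \<rho> \<kappa> h"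
      unfolding circle_sup_def T_def
      by (intro SUP_upper2 [OF z] SUP_upper2 [of v] SUP_upper) (simp_all add: v)
    then show "cmod (h (z + l *s v)) \<le> B"
      using real by simp
  qed (use r in auto)
  then show ?thesis
    using real by simp
qed simp

lemma c_inf_le_circle_sup:
  fixes \<rho> :: "complex ^ 'n \<Rightarrow> real"
  assumes \<rho>: "strictly_convex_domain \<rho>" and \<kappa>: "0 < \<kappa>" "\<kappa> < 1/4"
    and half: "\<And>z v. z \<in> sublevel \<rho> \<Longrightarrow> norm v = 1 \<Longrightarrow>
       2 * tau \<rho> z v (3 * \<kappa> * \<bar>\<rho> z\<bar>) \<le> tau \<rho> z v \<bar>\<rho> z\<bar>"
    and h: "holo_on h (sublevel \<rho>)"
    and eq: "\<And>z. z \<in> Y \<Longrightarrow> z \<in> sublevel \<rho> \<Longrightarrow> q z = h z"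
  shows "c_inf \<rho> \<kappa> Y N q \<le> ennreal (4 ^ N) * circle_sup \<rho> \<kappa> h"
proof (cases "circle_sup \<rho> \<kappa> h")
  case (real B)
  have cont: "continuous_on UNIV \<rho>"
    using \<rho> by (rule strictly_convex_domain_continuous)
  have hB: "cmod (h z) \<le> B" if "z \<in> sublevel \<rho>" for z
    using norm_le_circle_sup [OF \<rho> \<kappa> h that] real by simp
  have bound: "cmod (div_diff q z v ls) * tau \<rho> z v \<bar>\<rho> z\<bar> ^ (length ls - 1) \<le> 4 ^ N * B"
    if z: "z \<in> sublevel \<rho>" and v: "norm v = 1" and ls: "1 \<le> length ls" "length ls \<le> N" "distinct ls"
      "set ls \<subseteq> Lam \<rho> \<kappa> Y z v" for z v ls
  proof -
    define T where "T = tau \<rho> z v \<bar>\<rho> z\<bar>"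
    have small: "cmod l \<le> T / 2" if "l \<in> set ls" for l
      using that ls(4) half [OF z v] by (auto simp: Lam_def T_def)
    obtain k where k: "length ls = Suc k"
      using ls(1) by (cases "length ls") auto
    obtain l where l: "l \<in> set ls"
      using k by (cases ls) auto
    have T: "0 < T"
    proof -
      have "cmod l < tau \<rho> z v (3 * \<kappa> * \<bar>\<rho> z\<bar>)"
        using l ls(4) by (auto simp: Lam_def)
      then show ?thesis
        using half [OF z v] norm_ge_zero [of l] unfolding T_def by linarith
    qed
    have D: "z + l *s v \<in> sublevel \<rho>" if "cmod l < T" for l
      using less_tau_imp_sublevel [OF cont z v, of l] that by (simp add: T_def)
    have "div_diff q z v ls = div_diff h z v ls"
    proof (rule div_diff_cong)
      fix l assume l: "l \<in> set ls"
      have "z + l *s v \<in> sublevel \<rho>"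
        using small [OF l] T by (intro D) linarith
      moreover have "z + l *s v \<in> Y"
        using l ls(4) by (auto simp: Lam_def)
      ultimately show "q (z + l *s v) = h (z + l *s v)"
        by (intro eq)
    qed
    moreover have "cmod (div_diff h z v ls) \<le> B / (3/4 * T - T / 2) ^ length ls * (3/4 * T)"
    proof (rule div_diff_bound)
      have hol: "(\<lambda>l. h (z + l *s v)) holomorphic_on cball 0 (3/4 * T)"
        by (rule holo_on_complex_line [OF h]) (use T in \<open>auto intro!: D\<close>)
      show "continuous_on (cball 0 (3/4 * T)) (\<lambda>l. h (z + l *s v))"
        by (rule holomorphic_on_imp_continuous_on [OF hol])
      show "(\<lambda>l. h (z + l *s v)) holomorphic_on ball 0 (3/4 * T)"
        by (rule holomorphic_on_subset [OF hol ball_subset_cball])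
      show "cmod (h (z + l *s v)) \<le> B" if "cmod l = 3/4 * T" for l
        using that T by (intro hB D) auto
    qed (use ls T small in auto)
    ultimately have "cmod (div_diff q z v ls) * T ^ k \<le> B / (T / 4) ^ Suc k * (3/4 * T) * T ^ k"
      using T k by (intro mult_right_mono) auto
    also have "\<dots> = 3/4 * 4 ^ Suc k * B"
      using T by (simp add: field_simps)
    also have "\<dots> \<le> 4 ^ N * B"
    proof (rule mult_right_mono)
      have "(4::real) ^ Suc k \<le> 4 ^ N"
        using ls(2) k by (intro power_increasing) auto
      then show "3/4 * 4 ^ Suc k \<le> (4::real) ^ N"
        using zero_le_power [of "4::real" "Suc k"] by linarith
    qed (rule real(1))
    finally show ?thesis
      by (simp add: T_def k)
  qed
  have "c_inf \<rho> \<kappa> Y N q \<le> ennreal (4 ^ N * B)"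
    unfolding c_inf_def by (intro SUP_least) (auto intro!: ennreal_leI bound simp del: One_nat_def)
  also have "\<dots> = ennreal (4 ^ N) * circle_sup \<rho> \<kappa> h"
    using real by (simp add: ennreal_mult)
  finally show ?thesis .
qed (simp add: ennreal_mult_top)

lemma Linf_norm_quotient_le:
  fixes D :: "(complex ^ 'n) set"
  assumes D: "open D" and f: "holo_on f1 U" "holo_on f2 U" "D \<subseteq> U"
    and g: "bounded_decomposition D f1 f2 g g1 g2"
  shows "Linf_norm D (\<lambda>z. g z / of_real (max (cmod (f1 z)) (cmod (f2 z))))
      \<le> ennreal 2 * max (Linf_norm D g1) (Linf_norm D g2)"
proof -
  let ?m = "\<lambda>z. max (cmod (f1 z)) (cmod (f2 z))"
  let ?L = "\<lambda>g. esssup (lebesgue_on D) (\<lambda>z. ennreal (cmod (g z)))"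
  have meas: "h \<in> borel_measurable (lebesgue_on D)" if "continuous_on D h" for h :: "complex^'n \<Rightarrow> complex"
    using that D by (intro continuous_imp_measurable_on_sets_lebesgue) auto
  have [measurable]: "f1 \<in> borel_measurable (lebesgue_on D)" "f2 \<in> borel_measurable (lebesgue_on D)"
      "g \<in> borel_measurable (lebesgue_on D)"
    using f g by (auto intro!: meas intro: holo_on_imp_continuous_on
        continuous_on_subset [OF holo_on_imp_continuous_on] simp: bounded_decomposition_def)
  have pointwise: "cmod (g z / of_real (?m z)) \<le> cmod (g1 z) + cmod (g2 z)" if "z \<in> D" for z
  proof (cases "?m z = 0")
    case False
    then have m: "0 < ?m z"
      by (smt (verit) norm_ge_zero)
    have "cmod (g z) \<le> cmod (g1 z) * cmod (f1 z) + cmod (g2 z) * cmod (f2 z)"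
      using g that norm_triangle_ineq [of "g1 z * f1 z" "g2 z * f2 z"]
      by (simp add: bounded_decomposition_def norm_mult)
    also have "\<dots> \<le> cmod (g1 z) * ?m z + cmod (g2 z) * ?m z"
      by (intro add_mono mult_left_mono) auto
    finally show ?thesis
      using m by (simp add: norm_divide divide_le_eq distrib_right)
  qed simp
  have "AE z in lebesgue_on D. ennreal (cmod (g z / of_real (?m z))) \<le> ennreal 2 * max (?L g1) (?L g2)"
    using AE_space esssup_AE [of "\<lambda>z. ennreal (cmod (g1 z))" "lebesgue_on D"]
      esssup_AE [of "\<lambda>z. ennreal (cmod (g2 z))" "lebesgue_on D"]
  proof eventually_elim
    case (elim z)
    have "ennreal (cmod (g z / of_real (?m z))) \<le> ennreal (cmod (g1 z)) + ennreal (cmod (g2 z))"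
      using pointwise [of z] elim(1) by (simp flip: ennreal_plus add: ennreal_leI)
    also have "\<dots> \<le> max (?L g1) (?L g2) + max (?L g1) (?L g2)"
      using elim(2,3) by (intro add_mono) (auto simp: le_max_iff_disj)
    finally show ?case
      by (simp add: mult_2)
  qed
  then show ?thesis
    unfolding Linf_norm_def by (intro esssup_I) measurable
qed

theorem theorem6p3:
  fixes \<rho> :: "complex ^ 'n \<Rightarrow> real"
  assumes "CARD('n) \<ge> 2"
    and "strictly_convex_domain \<rho>"
  shows "\<exists>\<kappa>0>0. \<forall>\<kappa>. 0 < \<kappa> \<and> \<kappa> < \<kappa>0 \<longrightarrow>
    (\<forall>U f1 f2 X1 X2.
       closure (sublevel \<rho>) \<subseteq> U \<and> holo_on f1 U \<and> holo_on f2 U \<and>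
       X1 = zero_set U f1 \<and> X2 = zero_set U f2 \<and>
       transverse_to_bd \<rho> X1 \<and> transverse_to_bd \<rho> X2 \<and> complete_intersection2 (X1 \<inter> X2) \<longrightarrow>
       (\<exists>c>0. \<forall>g g1 g2. bounded_decomposition (sublevel \<rho>) f1 f2 g g1 g2 \<longrightarrow>
          Linf_norm (sublevel \<rho>) (\<lambda>z. g z / of_real (max (cmod (f1 z)) (cmod (f2 z))))
            \<le> ennreal c * max (Linf_norm (sublevel \<rho>) g1) (Linf_norm (sublevel \<rho>) g2)) \<and>
       (\<forall>N. \<exists>c>0. \<forall>g g1 g2. bounded_decomposition (sublevel \<rho>) f1 f2 g g1 g2 \<longrightarrow>
          c_inf \<rho> \<kappa> (X2 - X1) N (\<lambda>z. g z / f1 z) \<le> ennreal c * circle_sup \<rho> \<kappa> g1 \<and>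
          c_inf \<rho> \<kappa> (X1 - X2) N (\<lambda>z. g z / f2 z) \<le> ennreal c * circle_sup \<rho> \<kappa> g2))"
proof -
  obtain \<kappa>0 where \<kappa>0: "0 < \<kappa>0" "\<kappa>0 \<le> 1/4"
    "\<And>\<kappa> z v. 0 < \<kappa> \<Longrightarrow> \<kappa> < \<kappa>0 \<Longrightarrow> z \<in> sublevel \<rho> \<Longrightarrow> norm v = 1 \<Longrightarrow>
       2 * tau \<rho> z v (3 * \<kappa> * \<bar>\<rho> z\<bar>) \<le> tau \<rho> z v \<bar>\<rho> z\<bar>"
    using tau_half [OF assms(2)] by metis
  have D: "open (sublevel \<rho>)"
    by (rule open_sublevel [OF strictly_convex_domain_continuous [OF assms(2)]])
  show ?thesis
  proof (rule exI [of _ \<kappa>0], intro conjI allI impI, goal_cases)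
    case 1
    show ?case by (rule \<kappa>0(1))
  next
    case (2 \<kappa> U f1 f2 X1 X2)
    then have "sublevel \<rho> \<subseteq> U" "holo_on f1 U" "holo_on f2 U"
      using closure_subset by blast+
    then show ?case
      using Linf_norm_quotient_le [OF D] by (intro exI [of _ 2]) auto
  next
    case (3 \<kappa> U f1 f2 X1 X2 N)
    then have \<kappa>: "0 < \<kappa>" "\<kappa> < \<kappa>0" and X: "X1 = zero_set U f1" "X2 = zero_set U f2"
      by auto
    have le: "c_inf \<rho> \<kappa> Y N q \<le> ennreal (4 ^ N) * circle_sup \<rho> \<kappa> h"
      if "holo_on h (sublevel \<rho>)" "\<And>z. z \<in> Y \<Longrightarrow> z \<in> sublevel \<rho> \<Longrightarrow> q z = h z" for Y q h
      using c_inf_le_circle_sup [OF assms(2) \<kappa>(1) _ _ that] \<kappa> \<kappa>0(2) \<kappa>0(3) [OF \<kappa>] by auto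
    show ?case
    proof (intro exI [of _ "4 ^ N"] conjI allI impI)
      fix g g1 g2 assume g: "bounded_decomposition (sublevel \<rho>) f1 f2 g g1 g2"
      show "c_inf \<rho> \<kappa> (X2 - X1) N (\<lambda>z. g z / f1 z) \<le> ennreal (4 ^ N) * circle_sup \<rho> \<kappa> g1"
        using g by (intro le) (auto simp: bounded_decomposition_def X zero_set_def)
      show "c_inf \<rho> \<kappa> (X1 - X2) N (\<lambda>z. g z / f2 z) \<le> ennreal (4 ^ N) * circle_sup \<rho> \<kappa> g2"
        using g by (intro le) (auto simp: bounded_decomposition_def X zero_set_def)
    qed simp
  qed
qed

end
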